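(* Let $a\geq 36$. Let $H$ be the graph obtained from the complete bipartite graph $K_{a,3}$ by attaching the spider graph $S_{2,3}$, identifying the center of $S_{2,3}$ with a vertex of degree $3$ in $K_{a,3}$. Then $H$ has a Braess $K_3$ containing no Braess edges; that is, $H$ has an independent set of three vertices that is a Braess $K_3$ of $H$ and no pair of whose vertices is a Braess edge of $H$.
   Context: Graphs are finite, simple and undirected. The spider graph $S_{2,3}$ is the tree on $7$ vertices consisting of a center vertex of degree $3$ with three legs (paths) of length $2$ attached. For a connected graph $G$ with at least one edge, the random walk on $G$ has transition matrix $D^{-1}A$ ($A$ adjacency matrix, $D$ diagonal degree matrix), with stationary distribution $w_i=\deg(v_i)/(2|E(G)|)$ and mean first passage times $m_{i,j}$ ($i\ne j$). Kemeny's constant is $\mathcal{K}(G)=\sum_{j\neq i} w_j m_{i,j}$, which is independent of $i$; equivalently $\mathcal{K}(G)=\sum_{j\ge2}\frac{1}{1-\lambda_j}$ over the eigenvalues of $D^{-1}A$ other than the simple eigenvalue $\lambda_1=1$. A Braess $K_3$ of a connected graph $H$ is an independent set of three vertices such that the graph $\widetilde{H}$ obtained by adding all three edges between them satisfies $\mathcal{K}(\widetilde{H})>\mathcal{K}(H)$. A Braess edge of $H$ is a non-edge whose addition gives a graph $\widehat{H}$ with $\mathcal{K}(\widehat{H})\ge\mathcal{K}(H)$. *)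

theory Defs
  imports Complex_Main "Graph_Theory.Graph_Theory"
begin

text \<open>
  Finite simple undirected graphs are the \<^emph>\<open>pair graphs\<close> of the Graph Theory library:
  every undirected edge is represented by its two opposite arcs. Hence the out-degree of a vertex
  is its degree, and the number of arcs is twice the number of edges.
\<close>

section \<open>Random walks and Kemeny's constant\<close>

definition adjacency :: "'v pair_pre_digraph \<Rightarrow> 'v \<Rightarrow> 'v \<Rightarrow> real" where
  "adjacency G u v = (if (u, v) \<in> parcs G then 1 else 0)"

definition vdegree :: "'v pair_pre_digraph \<Rightarrow> 'v \<Rightarrow> nat" where
  "vdegree G v = out_degree (with_proj G) v"

definition transition :: "'v pair_pre_digraph \<Rightarrow> 'v \<Rightarrow> 'v \<Rightarrow> real" where
  "transition G u v = adjacency G u v / real (vdegree G u)"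

definition stationary :: "'v pair_pre_digraph \<Rightarrow> 'v \<Rightarrow> real" where
  "stationary G v = real (vdegree G v) / real (card (parcs G))"

text \<open>
  The trajectories \<open>x\<^sub>0, \<dots>, x\<^sub>n\<close> that start in \<open>i\<close> and are in \<open>j\<close> at time \<open>n\<close>, but at no time
  strictly between \<open>0\<close> and \<open>n\<close>. Successive vertices need not be adjacent here: a trajectory that
  is not a walk in \<open>G\<close> has probability \<open>0\<close>.
\<close>

definition first_passage_paths :: "'v pair_pre_digraph \<Rightarrow> 'v \<Rightarrow> 'v \<Rightarrow> nat \<Rightarrow> 'v list set" where
  "first_passage_paths G i j n =
     {xs. length xs = Suc n \<and> set xs \<subseteq> pverts G \<and> xs ! 0 = i \<and> xs ! n = j
        \<and> (\<forall>k. 0 < k \<and> k < n \<longrightarrow> xs ! k \<noteq> j)}"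

definition first_passage_prob :: "'v pair_pre_digraph \<Rightarrow> 'v \<Rightarrow> 'v \<Rightarrow> nat \<Rightarrow> real" where
  "first_passage_prob G i j n =
     (\<Sum>xs\<in>first_passage_paths G i j n. \<Prod>k<n. transition G (xs ! k) (xs ! Suc k))"

definition mean_first_passage :: "'v pair_pre_digraph \<Rightarrow> 'v \<Rightarrow> 'v \<Rightarrow> real" where
  "mean_first_passage G i j = (\<Sum>n. real n * first_passage_prob G i j n)"

text \<open>
  For a connected graph with at least one edge the sum below does not depend on the starting
  vertex \<open>i\<close>, so that the definite description is meaningful.
\<close>

definition kemeny :: "'v pair_pre_digraph \<Rightarrow> real" where
  "kemeny G = (THE k. \<forall>i\<in>pverts G.
     k = (\<Sum>j\<in>pverts G - {i}. stationary G j * mean_first_passage G i j))"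

section \<open>Braess edges and Braess triangles\<close>

definition connected_graph :: "'v pair_pre_digraph \<Rightarrow> bool" where
  "connected_graph G \<longleftrightarrow> pair_graph G \<and> connected (with_proj G)"

definition independent_vertices :: "'v pair_pre_digraph \<Rightarrow> 'v set \<Rightarrow> bool" where
  "independent_vertices G T \<longleftrightarrow> T \<subseteq> pverts G \<and> (\<forall>u\<in>T. \<forall>v\<in>T. (u, v) \<notin> parcs G)"

definition add_all_edges :: "'v pair_pre_digraph \<Rightarrow> 'v set \<Rightarrow> 'v pair_pre_digraph" where
  "add_all_edges G T =
     \<lparr> pverts = pverts G, parcs = parcs G \<union> {(u, v). u \<in> T \<and> v \<in> T \<and> u \<noteq> v} \<rparr>"

definition braess_K3 :: "'v pair_pre_digraph \<Rightarrow> 'v set \<Rightarrow> bool" where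
  "braess_K3 G T \<longleftrightarrow> connected_graph G \<and> card T = 3 \<and> independent_vertices G T
     \<and> kemeny (add_all_edges G T) > kemeny G"

text \<open>Unlike for a Braess triangle, the inequality for a Braess edge is not strict.\<close>

definition braess_edge :: "'v pair_pre_digraph \<Rightarrow> 'v \<Rightarrow> 'v \<Rightarrow> bool" where
  "braess_edge G u v \<longleftrightarrow> connected_graph G \<and> u \<in> pverts G \<and> v \<in> pverts G \<and> u \<noteq> v
     \<and> (u, v) \<notin> parcs G \<and> kemeny (add_all_edges G {u, v}) \<ge> kemeny G"

section \<open>Attaching the spider graph\<close>

definition spider_2_3 :: "'v pair_pre_digraph \<Rightarrow> 'v \<Rightarrow> bool" where
  "spider_2_3 S c \<longleftrightarrow> (\<exists>x1 x2 x3 y1 y2 y3. distinct [c, x1, x2, x3, y1, y2, y3]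
     \<and> pverts S = {c, x1, x2, x3, y1, y2, y3}
     \<and> parcs S = {(c, x1), (c, x2), (c, x3), (x1, y1), (x2, y2), (x3, y3)}
         \<union> {(x1, c), (x2, c), (x3, c), (y1, x1), (y2, x2), (y3, x3)})"

text \<open>
  Identifying a vertex of \<open>B\<close> with a vertex of \<open>S\<close> is expressed by letting the two graphs share
  exactly one vertex \<open>c\<close> and forming their union.
\<close>

definition attached_at :: "'v pair_pre_digraph \<Rightarrow> 'v pair_pre_digraph \<Rightarrow> 'v \<Rightarrow>
    'v pair_pre_digraph \<Rightarrow> bool" where
  "attached_at B S c H \<longleftrightarrow> pverts B \<inter> pverts S = {c}
     \<and> H = \<lparr> pverts = pverts B \<union> pverts S, parcs = parcs B \<union> parcs S \<rparr>"

end

theory Submission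
  imports Defs
begin

text \<open>
  Take for \<open>T\<close> the three neighbours of the centre in the spider. Kemeny's constant is
  \<open>(\<Sum>u v. d\<^sub>u d\<^sub>v R\<^sub>u\<^sub>v) / (4 |E|)\<close>, where \<open>R\<close> is the effective resistance, because the mean first
  passage time from \<open>i\<close> to \<open>j\<close> is \<open>\<Sum>k. d\<^sub>k (R\<^sub>i\<^sub>j + R\<^sub>k\<^sub>j - R\<^sub>i\<^sub>k) / 2\<close>. Resistances add up along the
  cut vertex \<open>c\<close>, so only the spider part changes when edges inside \<open>T\<close> are added. This gives
  \<open>(12a\<^sup>2 + 234a + 228) / (12a + 24)\<close> for \<open>H\<close>, \<open>(12a\<^sup>2 + 238a + 688/3) / (12a + 28)\<close> with one edge, and
  \<open>(12a\<^sup>2 + 252a + 222) / (12a + 36)\<close> with all three. The triangle increases the constant iff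
  \<open>a\<^sup>2 - 34a - 40 > 0\<close>, that is, \<open>a \<ge> 36\<close>, whereas a single edge always decreases it.
\<close>

section \<open>Mean first passage times\<close>

text \<open>Powers of the kernel \<open>P\<close> cut down to \<open>W\<close>, applied to
  \<open>h\<close>. If \<open>P\<close> is a transition matrix, \<open>h\<close> is constantly 1 and
  \<open>W\<close> omits just the target \<open>j\<close>, this is the probability that a walk from
  \<open>i\<close> avoids \<open>j\<close> at times 1 to \<open>n\<close>.\<close>

primrec killed_walk :: "('v \<Rightarrow> 'v \<Rightarrow> real) \<Rightarrow> 'v set \<Rightarrow> ('v \<Rightarrow> real) \<Rightarrow> nat \<Rightarrow> 'v \<Rightarrow> real" where
  "killed_walk P W h 0 i = h i"
| "killed_walk P W h (Suc n) i = (\<Sum>k\<in>W. P i k * killed_walk P W h n k)"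

lemma killed_mono:
  assumes "\<And>i k. 0 \<le> P i k" "\<And>i. i \<in> W \<Longrightarrow> g i \<le> h i" "i \<in> W"
  shows "killed_walk P W g n i \<le> killed_walk P W h n i"
  using assms(3) by (induction n arbitrary: i) (auto intro!: sum_mono mult_left_mono assms)

lemma killed_cmult: "killed_walk P W (\<lambda>i. M * h i) n i = M * killed_walk P W h n i"
  by (induction n arbitrary: i) (auto simp: sum_distrib_left mult.left_commute)

text \<open>The cut-down kernel is applied \<open>n\<close> times to the equation
  \<open>h = 1 + P h\<close>.\<close>

lemma killed_telescope:
  assumes "\<And>i. i \<in> W \<Longrightarrow> h i = 1 + (\<Sum>k\<in>W. P i k * h k)" "i \<in> W"
  shows "killed_walk P W h n i = killed_walk P W (\<lambda>_. 1) n i + killed_walk P W h (Suc n) i"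
  using assms(2)
proof (induction n arbitrary: i)
  case 0
  then show ?case using assms(1) by simp
next
  case (Suc n)
  have "killed_walk P W h (Suc n) i
      = (\<Sum>k\<in>W. P i k * (killed_walk P W (\<lambda>_. 1) n k + killed_walk P W h (Suc n) k))"
    using Suc.IH by (auto intro!: sum.cong)
  then show ?case by (simp add: distrib_left sum.distrib)
qed

text \<open>Since \<open>1 <= h <= M\<close> on \<open>W\<close>, the identity
  \<open>P h = h - 1\<close> gives \<open>P h <= (1 - 1/M) h\<close>, so every step contracts by
  \<open>q = 1 - 1/M\<close>. A solution \<open>h\<close> thus forces exponential decay.\<close>

lemma killed_geometric:
  assumes "finite W" "\<And>i k. 0 \<le> P i k" "\<And>i. i \<in> W \<Longrightarrow> 0 \<le> h i"
    and eq: "\<And>i. i \<in> W \<Longrightarrow> h i = 1 + (\<Sum>k\<in>W. P i k * h k)" and "i \<in> W"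
  shows "\<exists>M q. 0 \<le> q \<and> q < 1 \<and> (\<forall>n. 0 \<le> killed_walk P W h n i \<and> killed_walk P W h n i \<le> M * q ^ n)"
proof -
  have h1: "1 \<le> h k" if "k \<in> W" for k
    using eq[OF that] assms(2,3) by (simp add: sum_nonneg)
  define M where "M = Max (h ` W)"
  have hM: "h k \<le> M" if "k \<in> W" for k
    using that assms(1) by (simp add: M_def)
  have M: "1 \<le> M" using h1[OF \<open>i \<in> W\<close>] hM[OF \<open>i \<in> W\<close>] by simp
  define q where "q = 1 - 1 / M"
  have q: "0 \<le> q" "q < 1" using M by (auto simp: q_def)
  have nonneg: "0 \<le> killed_walk P W h n i" for n
  proof -
    have "killed_walk P W (\<lambda>i. 0 * h i) n i \<le> killed_walk P W h n i"
      using assms by (intro killed_mono) auto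
    then show ?thesis unfolding killed_cmult by simp
  qed
  have step: "killed_walk P W h (Suc n) i \<le> q * killed_walk P W h n i" for n
  proof -
    have "killed_walk P W h n i \<le> killed_walk P W (\<lambda>i. M * 1) n i"
      using assms(2) hM \<open>i \<in> W\<close> by (intro killed_mono) auto
    then have "killed_walk P W h n i / M \<le> killed_walk P W (\<lambda>_. 1) n i"
      unfolding killed_cmult using M by (simp add: field_simps)
    then show ?thesis
      using killed_telescope[of W h P i n, OF eq \<open>i \<in> W\<close>] 
      by (simp add: q_def algebra_simps add_divide_distrib del: killed_walk.simps)
  qed
  have "killed_walk P W h n i \<le> M * q ^ n" for n
  proof (induction n)
    case 0
    then show ?case using hM \<open>i \<in> W\<close> by simp
  next
    case (Suc n)
    then show ?case using step[of n] mult_left_mono[OF Suc q(1)] by (simp add: algebra_simps)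
  qed
  then show ?thesis using q nonneg by blast
qed

text \<open>Summation by parts, as in expressing the mean of a time \<open>T\<close> by its tails:
  \<open>f n\<close> stands for \<open>P(T = n)\<close>, \<open>s n\<close> for
  \<open>P(T > n)\<close> and \<open>r n\<close> for the sum of \<open>s\<close> from
  \<open>n\<close> on. The geometric bounds make both boundary terms vanish.\<close>

lemma sums_first_passage_weights:
  fixes s r f :: "nat \<Rightarrow> real"
  assumes r: "\<And>n. r n = s n + r (Suc n)" and s: "\<And>n. 0 \<le> s n" "\<And>n. s n \<le> M * q ^ n"
    and rq: "\<And>n. 0 \<le> r n" "\<And>n. r n \<le> M * q ^ n"
    and q: "0 \<le> q" "q < 1" and f: "\<And>n. f (Suc n) = s n - s (Suc n)"
  shows "(\<lambda>n. real n * f n) sums r 0"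
proof -
  \<comment> \<open>The value \<open>f 0\<close>, left open by the assumption on \<open>f\<close>,
    enters with weight 0.\<close>
  have partial: "(\<Sum>n<Suc N. real n * f n) = r 0 - r N - real N * s N" for N
  proof (induction N)
    case (Suc N)
    then show ?case using r[of N] by (simp add: f algebra_simps)
  qed simp
  have "(\<lambda>n. M * q ^ n) \<longlonglongrightarrow> M * 0"
    by (intro tendsto_mult tendsto_const LIMSEQ_realpow_zero q)
  then have "r \<longlonglongrightarrow> 0"
    using rq by (intro tendsto_sandwich[of "\<lambda>_. 0" r _ "\<lambda>n. M * q ^ n"]) auto
  moreover have "(\<lambda>n. M * (real n * q ^ n)) \<longlonglongrightarrow> M * 0"
    using q by (intro tendsto_mult tendsto_const powser_times_n_limit_0) auto
  then have "(\<lambda>n. real n * s n) \<longlonglongrightarrow> 0"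
    using s(1) mult_left_mono[OF s(2) of_nat_0_le_iff]
    by (intro tendsto_sandwich[of "\<lambda>_. 0" "\<lambda>n. real n * s n" _ "\<lambda>n. M * (real n * q ^ n)"])
      (auto simp: mult.left_commute)
  ultimately have "(\<lambda>N. r 0 - r N - real N * s N) \<longlonglongrightarrow> r 0 - 0 - 0"
    by (intro tendsto_diff tendsto_const)
  then have "(\<lambda>N. \<Sum>n<Suc N. real n * f n) \<longlonglongrightarrow> r 0"
    unfolding partial by simp
  then show ?thesis unfolding sums_def by (rule LIMSEQ_imp_Suc)
qed

section \<open>First-step analysis of first passage probabilities\<close>

lemma first_passage_paths_1:
  assumes "i \<in> pverts G" "j \<in> pverts G"
  shows "first_passage_paths G i j (Suc 0) = {[i, j]}"
  using assms by (auto simp: first_passage_paths_def length_Suc_conv)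

text \<open>With at least two steps, the second vertex of the path is at an intermediate time, hence
  not \<open>j\<close>. Paths of one step may enter \<open>j\<close> at once and are the base
  case.\<close>

lemma first_passage_paths_Suc:
  assumes "i \<in> pverts G"
  shows "first_passage_paths G i j (Suc (Suc n))
    = (\<Union>k\<in>pverts G - {j}. (#) i ` first_passage_paths G k j (Suc n))" (is "?L = ?R")
proof
  show "?L \<subseteq> ?R"
  proof
    fix xs assume xs: "xs \<in> ?L"
    then obtain ys where ys: "xs = i # ys" "length ys = Suc (Suc n)"
      by (cases xs) (auto simp: first_passage_paths_def)
    have int: "\<forall>k. 0 < k \<and> k < Suc (Suc n) \<longrightarrow> xs ! k \<noteq> j"
      using xs by (simp add: first_passage_paths_def)
    from int have "\<forall>k. k < Suc n \<longrightarrow> ys ! k \<noteq> j"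
      unfolding ys by (metis Suc_less_eq nth_Cons_Suc zero_less_Suc)
    moreover have "ys ! 0 \<in> set ys" using ys(2) by simp
    ultimately have "ys ! 0 \<in> pverts G - {j}" "ys \<in> first_passage_paths G (ys ! 0) j (Suc n)"
      using xs ys by (auto simp: first_passage_paths_def)
    then show "xs \<in> ?R" using ys by blast
  qed
  show "?R \<subseteq> ?L"
    using assms by (auto simp: first_passage_paths_def nth_Cons split: nat.splits)
      (metis gr0I)
qed

lemma finite_first_passage_paths:
  "finite (pverts G) \<Longrightarrow> finite (first_passage_paths G i j n)"
  by (rule finite_subset[OF _ finite_lists_length_eq[of "pverts G" "Suc n"]])
    (auto simp: first_passage_paths_def)

lemma first_passage_prob_Suc:
  assumes "finite (pverts G)" "i \<in> pverts G"
  shows "first_passage_prob G i j (Suc (Suc n))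
    = (\<Sum>k\<in>pverts G - {j}. transition G i k * first_passage_prob G k j (Suc n))"
proof -
  let ?w = "\<lambda>n xs. \<Prod>k<n. transition G (xs ! k) (xs ! Suc k)"
  have "first_passage_prob G i j (Suc (Suc n))
      = (\<Sum>k\<in>pverts G - {j}. sum (?w (Suc (Suc n))) ((#) i ` first_passage_paths G k j (Suc n)))"
    unfolding first_passage_prob_def first_passage_paths_Suc[OF assms(2)]
    using assms by (intro sum.UNION_disjoint)
      (auto simp: finite_first_passage_paths, auto simp: first_passage_paths_def)
  also have "\<dots> = (\<Sum>k\<in>pverts G - {j}. transition G i k * first_passage_prob G k j (Suc n))"
  proof (rule sum.cong[OF refl])
    fix k
    have "sum (?w (Suc (Suc n))) ((#) i ` first_passage_paths G k j (Suc n))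
        = (\<Sum>ys\<in>first_passage_paths G k j (Suc n). ?w (Suc (Suc n)) (i # ys))"
      by (subst sum.reindex) auto
    also have "\<dots> = (\<Sum>ys\<in>first_passage_paths G k j (Suc n). transition G i k * ?w (Suc n) ys)"
      by (intro sum.cong refl, subst prod.lessThan_Suc_shift)
        (auto simp: first_passage_paths_def simp del: prod.lessThan_Suc)
    finally show "sum (?w (Suc (Suc n))) ((#) i ` first_passage_paths G k j (Suc n))
        = transition G i k * first_passage_prob G k j (Suc n)"
      by (simp add: first_passage_prob_def sum_distrib_left)
  qed
  finally show ?thesis .
qed

text \<open>With \<open>T\<close> the time of first arrival,
  \<open>P(T = n + 1) = P(T > n) - P(T > n + 1)\<close>. For \<open>n = 0\<close> this is the row
  sum 1; the induction conditions on the first step.\<close>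

lemma first_passage_prob_killed:
  assumes "finite (pverts G)" "i \<in> pverts G" "j \<in> pverts G"
    and "\<And>i. i \<in> pverts G \<Longrightarrow> (\<Sum>k\<in>pverts G. transition G i k) = 1"
  shows "first_passage_prob G i j (Suc n) = killed_walk (transition G) (pverts G - {j}) (\<lambda>_. 1) n i
    - killed_walk (transition G) (pverts G - {j}) (\<lambda>_. 1) (Suc n) i"
  using assms(2)
proof (induction n arbitrary: i)
  case 0
  then show ?case
    using assms by (simp add: first_passage_prob_def first_passage_paths_1 sum_diff1)
next
  case (Suc n)
  then show ?case
    by (simp add: first_passage_prob_Suc[OF assms(1)] right_diff_distrib sum_subtractf
        flip: sum_subtractf)
qed

lemma transition_nonneg: "0 \<le> transition G i k"
  by (simp add: transition_def adjacency_def)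

text \<open>Solving the hitting time equations suffices: summation by parts applies to the survival
  probabilities, and the remainder at time 0 is \<open>h i\<close>.\<close>

lemma mean_first_passage_eqI:
  assumes fin: "finite (pverts G)" and i: "i \<in> pverts G - {j}" and j: "j \<in> pverts G"
    and row: "\<And>i. i \<in> pverts G \<Longrightarrow> (\<Sum>k\<in>pverts G. transition G i k) = 1"
    and h: "h j = 0" "\<And>i. i \<in> pverts G - {j} \<Longrightarrow> h i = 1 + (\<Sum>k\<in>pverts G. transition G i k * h k)"
  shows "mean_first_passage G i j = h i"
proof -
  let ?V = "pverts G" and ?P = "transition G"
  define W where "W = ?V - {j}"
  have finW: "finite W" using fin by (simp add: W_def)
  have hW: "h k = 1 + (\<Sum>l\<in>W. ?P k l * h l)" if "k \<in> W" for k
    using h(2)[of k] that fin j h(1) by (simp add: W_def sum_diff1)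
  have nonneg: "0 \<le> h k" if "k \<in> ?V" for k
  proof -
    \<comment> \<open>Minimum principle: at a minimiser other than \<open>j\<close>, the value would
      be 1 plus an average of values that are no smaller.\<close>
    obtain m where m: "m \<in> ?V" "\<And>l. l \<in> ?V \<Longrightarrow> h m \<le> h l"
      using ex_min_if_finite[of "h ` ?V"] fin j
      by (metis arg_min_if_finite(1) arg_min_least empty_iff)
    have "m = j"
    proof (rule ccontr)
      assume "m \<noteq> j"
      then have "h m = 1 + (\<Sum>k\<in>?V. ?P m k * h k)" using h(2) m(1) by simp
      moreover have "(\<Sum>k\<in>?V. ?P m k * h m) \<le> (\<Sum>k\<in>?V. ?P m k * h k)"
        using m(2) by (intro sum_mono mult_left_mono transition_nonneg)
      ultimately show False using row[OF m(1)] by (simp flip: sum_distrib_right)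
    qed
    then show ?thesis using m(2)[OF that] h(1) by simp
  qed
  let ?s = "\<lambda>n. killed_walk ?P W (\<lambda>_. 1) n i" and ?r = "\<lambda>n. killed_walk ?P W h n i"
  have iW: "i \<in> W" using i by (simp add: W_def)
  obtain M q where q: "0 \<le> q" "q < 1" and r: "\<And>n. 0 \<le> ?r n" "\<And>n. ?r n \<le> M * q ^ n"
    using killed_geometric[of W ?P h i, OF finW transition_nonneg nonneg hW iW]
    by (auto simp: W_def)
  have tele: "?r n = ?s n + ?r (Suc n)" for n
    by (rule killed_telescope[OF hW iW])
  have s0: "0 \<le> ?s n" for n
  proof -
    have "killed_walk ?P W (\<lambda>i. 0 * 1) n i \<le> ?s n"
      using iW transition_nonneg by (intro killed_mono) auto
    then show ?thesis unfolding killed_cmult by simp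
  qed
  have sq: "?s n \<le> M * q ^ n" for n
    using tele[of n] r(1)[of "Suc n"] r(2)[of n] by linarith
  have "(\<lambda>n. real n * first_passage_prob G i j n) sums ?r 0"
    by (rule sums_first_passage_weights[where r = ?r, OF tele s0 sq r q])
      (use first_passage_prob_killed[OF fin _ j row, of i] i in \<open>simp add: W_def\<close>)
  then show ?thesis by (simp add: mean_first_passage_def sums_iff)
qed

section \<open>Kemeny's constant and effective resistances\<close>

lemma vdegree_conv_adjacency:
  assumes "pair_graph G"
  shows "real (vdegree G v) = (\<Sum>k\<in>pverts G. adjacency G v k)"
proof -
  interpret pair_graph G by fact
  have "out_arcs (with_proj G) v = Pair v ` {k \<in> pverts G. (v, k) \<in> parcs G}"
    by (auto simp: out_arcs_def dest: in_arcsD2)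
  then have "vdegree G v = card {k \<in> pverts G. (v, k) \<in> parcs G}"
    by (simp add: vdegree_def out_degree_def card_image inj_on_def)
  then show ?thesis
    using pair_finite_verts by (simp add: adjacency_def sum.If_cases Int_def)
qed

lemma card_parcs_conv_vdegree:
  assumes "pair_graph G"
  shows "real (card (parcs G)) = (\<Sum>v\<in>pverts G. real (vdegree G v))"
proof -
  interpret pair_graph G by fact
  \<comment> \<open>The separate name on the right-hand side of the next equation keeps rewriting
    with it from looping.\<close>
  define E where "E = parcs G"
  have "parcs G = (SIGMA v:pverts G. {k \<in> pverts G. (v, k) \<in> E})"
    by (auto simp: E_def dest: in_arcsD1 in_arcsD2)
  then have "card (parcs G) = (\<Sum>v\<in>pverts G. card {k \<in> pverts G. (v, k) \<in> E})"
    by (simp only:) (rule card_SigmaI, simp_all add: pair_finite_verts)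
  moreover have "real (vdegree G v) = real (card {k \<in> pverts G. (v, k) \<in> E})" for v
    using vdegree_conv_adjacency[OF assms, of v] pair_finite_verts
    by (simp add: E_def adjacency_def sum.If_cases Int_def)
  ultimately show ?thesis by simp
qed

definition laplacian :: "'v pair_pre_digraph \<Rightarrow> ('v \<Rightarrow> real) \<Rightarrow> 'v \<Rightarrow> real" where
  "laplacian G f i = (\<Sum>k\<in>pverts G. adjacency G i k * (f i - f k))"

text \<open>
  Up to the normalisation by \<open>\<tau>\<close>, the equation says that \<open>(R\<^sub>i\<^sub>j + R\<^sub>k\<^sub>j - R\<^sub>i\<^sub>k) / 2\<close> is the
  potential at \<open>i\<close> of a unit current from \<open>k\<close> to \<open>j\<close>; this determines the effective resistances.
\<close>

definition resistance :: "'v pair_pre_digraph \<Rightarrow> ('v \<Rightarrow> 'v \<Rightarrow> real) \<Rightarrow> bool" where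
  "resistance G R \<longleftrightarrow> (\<forall>i\<in>pverts G. R i i = 0)
     \<and> (\<forall>i\<in>pverts G. \<forall>j\<in>pverts G. R i j = R j i)
     \<and> (\<exists>\<tau>. \<forall>i\<in>pverts G. \<forall>j\<in>pverts G.
          laplacian G (\<lambda>u. R u j) i = \<tau> i - (if i = j then 2 else 0))"

text \<open>For effective resistances, twice the degree-Kirchhoff index, since ordered pairs are
  summed.\<close>

definition resistance_sum :: "'v pair_pre_digraph \<Rightarrow> ('v \<Rightarrow> 'v \<Rightarrow> real) \<Rightarrow> real" where
  "resistance_sum G R
     = (\<Sum>u\<in>pverts G. \<Sum>v\<in>pverts G. real (vdegree G u) * real (vdegree G v) * R u v)"

text \<open>A combination of potentials solves the hitting time equations, and averaging it over the
  targets cancels all that depends on the start.\<close>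

lemma kemeny_resistance:
  assumes G: "pair_graph G" and ne: "pverts G \<noteq> {}"
    and deg: "\<And>v. v \<in> pverts G \<Longrightarrow> vdegree G v \<noteq> 0"
    and R: "resistance G R"
  shows "kemeny G = resistance_sum G R / (2 * real (card (parcs G)))"
proof -
  interpret pair_graph G by fact
  let ?V = "pverts G" and ?D = "real (card (parcs G))"
  define d where "d v = real (vdegree G v)" for v
  note fin = pair_finite_verts
  obtain \<tau> where R0: "\<And>i. i \<in> ?V \<Longrightarrow> R i i = 0"
    and \<tau>: "\<And>i j. i \<in> ?V \<Longrightarrow> j \<in> ?V \<Longrightarrow>
      laplacian G (\<lambda>u. R u j) i = \<tau> i - (if i = j then 2 else 0)"
    using R unfolding resistance_def by blast
  have dpos: "d v > 0" if "v \<in> ?V" for v using deg[OF that] by (simp add: d_def)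
  have D: "?D = (\<Sum>v\<in>?V. d v)" by (simp add: card_parcs_conv_vdegree[OF G] d_def)
  have Dpos: "?D > 0" unfolding D using dpos ne fin by (intro sum_pos) auto
  have row: "(\<Sum>k\<in>?V. transition G i k) = 1" if "i \<in> ?V" for i
    using dpos[OF that] vdegree_conv_adjacency[OF G, of i]
    by (simp add: transition_def d_def flip: sum_divide_distrib)
  \<comment> \<open>The potential at \<open>i\<close> when current \<open>d k\<close> enters at
    every \<open>k\<close> and all of it leaves at \<open>j\<close>.\<close>
  define h where "h j i = (\<Sum>k\<in>?V. d k * (R i j + R k j - R i k)) / 2" for i j
  have hit: "mean_first_passage G i j = h j i" if i: "i \<in> ?V - {j}" and j: "j \<in> ?V" for i j
  proof (rule mean_first_passage_eqI[OF fin i j row])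
    show "h j j = 0" unfolding h_def
    proof -
      have "R j k = R k j" if "k \<in> ?V" for k using R j that by (auto simp: resistance_def)
      then show "(\<Sum>k\<in>?V. d k * (R j j + R k j - R j k)) / 2 = 0"
        by (simp add: R0[OF j])
    qed
  next
    fix i assume i: "i \<in> ?V - {j}"
    have "laplacian G (h j) i
        = (\<Sum>k\<in>?V. d k * (laplacian G (\<lambda>u. R u j) i - laplacian G (\<lambda>u. R u k) i)) / 2"
    proof -
      have "laplacian G (h j) i = (\<Sum>l\<in>?V. \<Sum>k\<in>?V.
          adjacency G i l * (d k * (R i j + R k j - R i k) - d k * (R l j + R k j - R l k))) / 2"
        unfolding laplacian_def h_def
        by (simp add: sum_divide_distrib sum_distrib_left diff_divide_distrib
            flip: sum_subtractf times_divide_eq_right)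
      also have "\<dots> = (\<Sum>k\<in>?V. \<Sum>l\<in>?V.
          adjacency G i l * (d k * (R i j + R k j - R i k) - d k * (R l j + R k j - R l k))) / 2"
        by (subst sum.swap) simp
      also have "\<dots> = (\<Sum>k\<in>?V. d k * (laplacian G (\<lambda>u. R u j) i - laplacian G (\<lambda>u. R u k) i)) / 2"
        unfolding laplacian_def sum_distrib_left sum_subtractf[symmetric]
        by (intro arg_cong[where f = "\<lambda>x. x / 2"] sum.cong) (simp_all add: algebra_simps)
      finally show ?thesis .
    qed
    \<comment> \<open>In the difference \<open>\<tau> i\<close> cancels; as \<open>i\<close> is not
      \<open>j\<close>, only the source term at \<open>k = i\<close> remains.\<close>
    also have "\<dots> = (\<Sum>k\<in>?V. d k * (if i = k then 2 else 0)) / 2"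
      using i j \<tau> by (auto intro!: arg_cong[where f = "\<lambda>x. x / 2"] sum.cong)
    also have "\<dots> = d i" using i fin by (simp add: if_distrib cong: if_cong)
    finally have L: "laplacian G (h j) i = d i" .
    have "laplacian G (h j) i = d i * h j i - (\<Sum>k\<in>?V. adjacency G i k * h j k)"
      unfolding laplacian_def d_def vdegree_conv_adjacency[OF G]
      by (simp add: right_diff_distrib sum_subtractf sum_distrib_right)
    then have "d i * h j i = d i + (\<Sum>k\<in>?V. adjacency G i k * h j k)" using L by simp
    then have "h j i = 1 + (\<Sum>k\<in>?V. adjacency G i k * h j k) / d i"
      using dpos[of i] i by (simp add: field_simps)
    then show "h j i = 1 + (\<Sum>k\<in>?V. transition G i k * h j k)"
      by (simp add: transition_def d_def sum_divide_distrib)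
  qed
  have K: "(\<Sum>j\<in>?V - {i}. stationary G j * mean_first_passage G i j)
      = resistance_sum G R / (2 * ?D)" if i: "i \<in> ?V" for i
  proof -
    have hii: "h i i = 0"
    proof -
      have "R i k = R k i" if "k \<in> ?V" for k using R i that by (auto simp: resistance_def)
      then show ?thesis by (simp add: h_def R0[OF i])
    qed
    have "(\<Sum>j\<in>?V - {i}. stationary G j * mean_first_passage G i j)
        = (\<Sum>j\<in>?V - {i}. d j / ?D * h j i)"
      using i by (intro sum.cong) (auto simp: stationary_def d_def hit)
    also have "\<dots> = (\<Sum>j\<in>?V. d j * h j i) / ?D"
      using i fin hii by (simp add: sum_diff1 sum_divide_distrib)
    also have "(\<Sum>j\<in>?V. d j * h j i)
        = (\<Sum>j\<in>?V. \<Sum>k\<in>?V. (d j * d k * R i j + d j * d k * R k j - d j * d k * R i k) / 2)"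
    proof (rule sum.cong[OF refl])
      fix j
      have "d j * h j i = (\<Sum>k\<in>?V. d j * (d k * (R i j + R k j - R i k)) / 2)"
        by (simp add: h_def sum_distrib_left flip: sum_divide_distrib)
      then show "d j * h j i
          = (\<Sum>k\<in>?V. (d j * d k * R i j + d j * d k * R k j - d j * d k * R i k) / 2)"
        by (simp add: algebra_simps)
    qed
    also have "\<dots>
        = ((\<Sum>j\<in>?V. \<Sum>k\<in>?V. d j * d k * R i j) + (\<Sum>j\<in>?V. \<Sum>k\<in>?V. d j * d k * R k j)
           - (\<Sum>j\<in>?V. \<Sum>k\<in>?V. d j * d k * R i k)) / 2"
      by (simp add: sum.distrib sum_subtractf flip: sum_divide_distrib)
    \<comment> \<open>This sum and the first one are the two that involve the start
      \<open>i\<close>; being equal, they cancel.\<close>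
    also have "(\<Sum>j\<in>?V. \<Sum>k\<in>?V. d j * d k * R i k) = (\<Sum>j\<in>?V. \<Sum>k\<in>?V. d j * d k * R i j)"
      by (subst sum.swap) (simp add: mult.commute)
    also have "(\<Sum>j\<in>?V. \<Sum>k\<in>?V. d j * d k * R k j) = resistance_sum G R"
      unfolding resistance_sum_def by (subst sum.swap) (simp add: d_def mult.commute)
    finally show ?thesis by simp
  qed
  show ?thesis
    unfolding kemeny_def using ne K by (intro the_equality) auto
qed

section \<open>Gluing at a cut vertex\<close>

lemma adjacency_outside:
  assumes "pair_graph G" "i \<notin> pverts G \<or> k \<notin> pverts G"
  shows "adjacency G i k = 0"
proof -
  interpret pair_graph G by fact
  show ?thesis using assms(2) by (auto simp: adjacency_def dest: in_arcsD1 in_arcsD2)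
qed

lemma vdegree_outside:
  "pair_graph G \<Longrightarrow> v \<notin> pverts G \<Longrightarrow> vdegree G v = 0"
  using vdegree_conv_adjacency[of G v] by (simp add: adjacency_outside)

lemma sum_vdegree_superset:
  assumes "pair_graph G" "finite V" "pverts G \<subseteq> V"
  shows "(\<Sum>v\<in>V. real (vdegree G v) * f v) = (\<Sum>v\<in>pverts G. real (vdegree G v) * f v)"
  using assms by (intro sum.mono_neutral_right) (auto simp: vdegree_outside)

text \<open>The Laplacian annihilates constants. In a glued graph, the other part contributes such a
  constant to the resistance.\<close>

lemma laplacian_cong:
  assumes "i \<in> pverts G" "\<And>k. k \<in> pverts G \<Longrightarrow> f k - g k = f i - g i"
  shows "laplacian G f i = laplacian G g i"
  unfolding laplacian_def
proof (rule sum.cong[OF refl])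
  fix k assume "k \<in> pverts G"
  then have "f i - f k = g i - g k" using assms(2)[of k] by linarith
  then show "adjacency G i k * (f i - f k) = adjacency G i k * (g i - g k)" by simp
qed

text \<open>In the cross terms of a glued graph, a part enters only through this moment at the cut
  vertex and its number of arcs.\<close>

definition resistance_moment :: "'v pair_pre_digraph \<Rightarrow> ('v \<Rightarrow> 'v \<Rightarrow> real) \<Rightarrow> 'v \<Rightarrow> real" where
  "resistance_moment G R c = (\<Sum>v\<in>pverts G. real (vdegree G v) * R v c)"

locale glued =
  fixes G1 G2 :: "'v pair_pre_digraph" and c :: 'v
  assumes graph1: "pair_graph G1" and graph2: "pair_graph G2"
    and cut: "pverts G1 \<inter> pverts G2 = {c}"
begin

definition glue :: "'v pair_pre_digraph" where
  "glue = \<lparr> pverts = pverts G1 \<union> pverts G2, parcs = parcs G1 \<union> parcs G2 \<rparr>"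

text \<open>The retractions of the glued graph onto its parts turn additivity of resistances along the
  cut vertex into a single formula without case distinctions.\<close>

definition retract1 :: "'v \<Rightarrow> 'v" where "retract1 u = (if u \<in> pverts G1 then u else c)"
definition retract2 :: "'v \<Rightarrow> 'v" where "retract2 u = (if u \<in> pverts G2 then u else c)"

definition glue_resistance ::
    "('v \<Rightarrow> 'v \<Rightarrow> real) \<Rightarrow> ('v \<Rightarrow> 'v \<Rightarrow> real) \<Rightarrow> 'v \<Rightarrow> 'v \<Rightarrow> real" where
  "glue_resistance R1 R2 u v
     = R1 (retract1 u) (retract1 v) + R2 (retract2 u) (retract2 v)"

lemma finite_parts [simp]: "finite (pverts G1)" "finite (pverts G2)"
  using graph1 graph2
  by (auto simp: pair_graph_def pair_digraph_def pair_fin_digraph_def pair_fin_digraph_axioms_def)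

lemma c_in_parts [simp]: "c \<in> pverts G1" "c \<in> pverts G2"
  using cut by auto

lemma glue_verts [simp]: "pverts glue = pverts G1 \<union> pverts G2"
  by (simp add: glue_def)

lemma retract_simps [simp]:
  "u \<in> pverts G1 \<Longrightarrow> retract1 u = u" "u \<in> pverts G2 \<Longrightarrow> retract1 u = c"
  "u \<in> pverts G2 \<Longrightarrow> retract2 u = u" "u \<in> pverts G1 \<Longrightarrow> retract2 u = c"
  using cut by (auto simp: retract1_def retract2_def)

lemma retract_in [simp]: "retract1 u \<in> pverts G1" "retract2 u \<in> pverts G2"
  by (auto simp: retract1_def retract2_def)

lemma pair_graph_glue: "pair_graph glue"
proof -
  interpret A: pair_graph G1 by (rule graph1)
  interpret B: pair_graph G2 by (rule graph2)
  show ?thesis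
  proof
    show "symmetric (with_proj glue)"
      using A.arcs_symmetric B.arcs_symmetric by (auto simp: symmetric_def glue_def intro: symI)
  qed (auto simp: glue_def dest: A.in_arcsD1 A.in_arcsD2 B.in_arcsD1 B.in_arcsD2
      A.no_loops' B.no_loops' A.pair_no_loops B.pair_no_loops
      intro: A.pair_finite_arcs B.pair_finite_arcs)
qed

lemma adjacency_glue: "adjacency glue i k = adjacency G1 i k + adjacency G2 i k"
proof -
  interpret A: pair_graph G1 by (rule graph1)
  interpret B: pair_graph G2 by (rule graph2)
  \<comment> \<open>A common arc would have both ends equal to \<open>c\<close>, hence be a
    loop.\<close>
  have "(i, k) \<notin> parcs G1 \<inter> parcs G2"
    using cut A.in_arcsD1 A.in_arcsD2 B.in_arcsD1 B.in_arcsD2 A.no_loops'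
    by (metis IntD1 IntD2 IntI singletonD)
  then show ?thesis by (auto simp: adjacency_def glue_def)
qed

text \<open>The shared vertex needs no correction: each adjacency function vanishes outside its own
  part, so both sums extend to all vertices.\<close>

lemma sum_adjacency_glue:
  "(\<Sum>k\<in>pverts glue. adjacency glue i k * f k)
    = (\<Sum>k\<in>pverts G1. adjacency G1 i k * f k) + (\<Sum>k\<in>pverts G2. adjacency G2 i k * f k)"
proof -
  have "(\<Sum>k\<in>pverts glue. adjacency G1 i k * f k) = (\<Sum>k\<in>pverts G1. adjacency G1 i k * f k)"
    by (intro sum.mono_neutral_right) (auto simp: adjacency_outside[OF graph1])
  moreover have "(\<Sum>k\<in>pverts glue. adjacency G2 i k * f k) = (\<Sum>k\<in>pverts G2. adjacency G2 i k * f k)"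
    by (intro sum.mono_neutral_right) (auto simp: adjacency_outside[OF graph2])
  ultimately show ?thesis by (simp add: adjacency_glue distrib_right sum.distrib)
qed

lemma vdegree_glue: "real (vdegree glue v) = real (vdegree G1 v) + real (vdegree G2 v)"
  using sum_adjacency_glue[of v "\<lambda>_. 1"]
  by (simp add: vdegree_conv_adjacency graph1 graph2 pair_graph_glue del: glue_verts)

lemma laplacian_glue: "laplacian glue f i = laplacian G1 f i + laplacian G2 f i"
  unfolding laplacian_def by (rule sum_adjacency_glue)

lemma sum_vdegree_glue:
  "(\<Sum>v\<in>pverts glue. real (vdegree glue v) * f v)
    = (\<Sum>v\<in>pverts G1. real (vdegree G1 v) * f v) + (\<Sum>v\<in>pverts G2. real (vdegree G2 v) * f v)"
proof -
  have "(\<Sum>v\<in>pverts glue. real (vdegree G1 v) * f v) = (\<Sum>v\<in>pverts G1. real (vdegree G1 v) * f v)"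
    "(\<Sum>v\<in>pverts glue. real (vdegree G2 v) * f v) = (\<Sum>v\<in>pverts G2. real (vdegree G2 v) * f v)"
    by (intro sum_vdegree_superset graph1 graph2; simp)+
  then show ?thesis by (simp add: vdegree_glue distrib_right sum.distrib)
qed

lemma card_parcs_glue: "real (card (parcs glue)) = real (card (parcs G1)) + real (card (parcs G2))"
  using sum_vdegree_glue[of "\<lambda>_. 1"]
  by (simp add: card_parcs_conv_vdegree graph1 graph2 pair_graph_glue del: glue_verts)

lemma laplacian_outside:
  "i \<notin> pverts G1 \<Longrightarrow> laplacian G1 f i = 0" "i \<notin> pverts G2 \<Longrightarrow> laplacian G2 f i = 0"
  by (simp_all add: laplacian_def adjacency_outside graph1 graph2)

lemma resistance_glue:
  assumes R1: "resistance G1 R1" and R2: "resistance G2 R2"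
  shows "resistance glue (glue_resistance R1 R2)"
proof -
  obtain \<tau>1 where \<tau>1: "\<And>i j. i \<in> pverts G1 \<Longrightarrow> j \<in> pverts G1 \<Longrightarrow>
      laplacian G1 (\<lambda>u. R1 u j) i = \<tau>1 i - (if i = j then 2 else 0)"
    using R1 unfolding resistance_def by blast
  obtain \<tau>2 where \<tau>2: "\<And>i j. i \<in> pverts G2 \<Longrightarrow> j \<in> pverts G2 \<Longrightarrow>
      laplacian G2 (\<lambda>u. R2 u j) i = \<tau>2 i - (if i = j then 2 else 0)"
    using R2 unfolding resistance_def by blast
  let ?R = "glue_resistance R1 R2"
  \<comment> \<open>The sinks at \<open>retract1 j\<close> and \<open>retract2 j\<close> are always
    one at \<open>j\<close> and one at \<open>c\<close>. The latter does not depend on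
    \<open>j\<close> and is absorbed here.\<close>
  define \<tau> where "\<tau> i = (if i \<in> pverts G1 then \<tau>1 i else 0) + (if i \<in> pverts G2 then \<tau>2 i else 0)
    - (if i = c then 2 else 0)" for i
  have L1: "laplacian G1 (\<lambda>u. ?R u j) i
      = (if i \<in> pverts G1 then \<tau>1 i - (if i = retract1 j then 2 else 0) else 0)" for i j
  proof (cases "i \<in> pverts G1")
    case True
    then have "laplacian G1 (\<lambda>u. ?R u j) i = laplacian G1 (\<lambda>u. R1 u (retract1 j)) i"
      by (intro laplacian_cong) (auto simp: glue_resistance_def)
    then show ?thesis using \<tau>1[of i "retract1 j"] True by simp
  qed (simp add: laplacian_outside)
  have L2: "laplacian G2 (\<lambda>u. ?R u j) i
      = (if i \<in> pverts G2 then \<tau>2 i - (if i = retract2 j then 2 else 0) else 0)" for i j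
  proof (cases "i \<in> pverts G2")
    case True
    then have "laplacian G2 (\<lambda>u. ?R u j) i = laplacian G2 (\<lambda>u. R2 u (retract2 j)) i"
      by (intro laplacian_cong) (auto simp: glue_resistance_def)
    then show ?thesis using \<tau>2[of i "retract2 j"] True by simp
  qed (simp add: laplacian_outside)
  have "laplacian glue (\<lambda>u. ?R u j) i = \<tau> i - (if i = j then 2 else 0)"
    if "i \<in> pverts glue" "j \<in> pverts glue" for i j
    using that cut unfolding laplacian_glue L1 L2 \<tau>_def retract1_def retract2_def by auto
  moreover have "?R i i = 0" "?R i j = ?R j i" for i j
    using R1 R2 by (auto simp: resistance_def glue_resistance_def)
  ultimately show ?thesis unfolding resistance_def by blast
qed

text \<open>The double sum splits into four blocks. The diagonal ones reproduce the parts; in the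
  two equal mixed ones the resistance is \<open>R1 u c + R2 v c\<close>, so each moment is weighted
  by the other part's total degree.\<close>

lemma resistance_sum_glue:
  assumes R1: "resistance G1 R1" and R2: "resistance G2 R2"
  shows "resistance_sum glue (glue_resistance R1 R2)
    = resistance_sum G1 R1 + resistance_sum G2 R2
      + 2 * (real (card (parcs G1)) * resistance_moment G2 R2 c
           + real (card (parcs G2)) * resistance_moment G1 R1 c)"
proof -
  let ?R = "glue_resistance R1 R2"
  let ?d1 = "\<lambda>v. real (vdegree G1 v)" and ?d2 = "\<lambda>v. real (vdegree G2 v)"
  have R0: "R1 c c = 0" "R2 c c = 0" using R1 R2 by (auto simp: resistance_def)
  have "resistance_sum glue ?R = (\<Sum>u\<in>pverts glue. real (vdegree glue u) *
      (\<Sum>v\<in>pverts glue. real (vdegree glue v) * ?R u v))"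
    by (simp add: resistance_sum_def sum_distrib_left mult.assoc)
  also have "\<dots> = (\<Sum>u\<in>pverts G1. ?d1 u * (\<Sum>v\<in>pverts G1. ?d1 v * ?R u v))
      + (\<Sum>u\<in>pverts G1. ?d1 u * (\<Sum>v\<in>pverts G2. ?d2 v * ?R u v))
      + ((\<Sum>u\<in>pverts G2. ?d2 u * (\<Sum>v\<in>pverts G1. ?d1 v * ?R u v))
      + (\<Sum>u\<in>pverts G2. ?d2 u * (\<Sum>v\<in>pverts G2. ?d2 v * ?R u v)))"
    unfolding sum_vdegree_glue by (simp add: distrib_left sum.distrib)
  also have "(\<Sum>u\<in>pverts G1. ?d1 u * (\<Sum>v\<in>pverts G1. ?d1 v * ?R u v)) = resistance_sum G1 R1"
    by (simp add: resistance_sum_def glue_resistance_def R0 sum_distrib_left mult.assoc)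
  also have "(\<Sum>u\<in>pverts G2. ?d2 u * (\<Sum>v\<in>pverts G2. ?d2 v * ?R u v)) = resistance_sum G2 R2"
    by (simp add: resistance_sum_def glue_resistance_def R0 sum_distrib_left mult.assoc)
  also have "(\<Sum>u\<in>pverts G2. ?d2 u * (\<Sum>v\<in>pverts G1. ?d1 v * ?R u v))
      = (\<Sum>u\<in>pverts G1. ?d1 u * (\<Sum>v\<in>pverts G2. ?d2 v * ?R v u))"
    unfolding sum_distrib_left by (subst sum.swap) (simp add: mult.left_commute)
  also have "\<dots> = (\<Sum>u\<in>pverts G1. ?d1 u * (\<Sum>v\<in>pverts G2. ?d2 v * ?R u v))"
    using R1 R2 by (simp add: resistance_def glue_resistance_def)
  also have "\<dots> = (\<Sum>u\<in>pverts G1. ?d1 u * (\<Sum>v\<in>pverts G2. ?d2 v * (R1 u c + R2 v c)))"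
    using R2 by (simp add: resistance_def glue_resistance_def)
  also have "\<dots> = real (card (parcs G1)) * resistance_moment G2 R2 c
      + real (card (parcs G2)) * resistance_moment G1 R1 c"
    by (simp add: card_parcs_conv_vdegree graph1 graph2 resistance_moment_def distrib_left
        sum.distrib sum_distrib_right mult.assoc flip: sum_distrib_left)
      (simp add: sum_distrib_left sum_distrib_right ac_simps, rule sum.swap)
  finally show ?thesis by simp
qed

lemma kemeny_glue:
  assumes "resistance G1 R1" "resistance G2 R2"
    and "\<And>v. v \<in> pverts G1 \<Longrightarrow> vdegree G1 v \<noteq> 0" "\<And>v. v \<in> pverts G2 \<Longrightarrow> vdegree G2 v \<noteq> 0"
  shows "kemeny glue = (resistance_sum G1 R1 + resistance_sum G2 R2
      + 2 * (real (card (parcs G1)) * resistance_moment G2 R2 c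
           + real (card (parcs G2)) * resistance_moment G1 R1 c))
      / (2 * (real (card (parcs G1)) + real (card (parcs G2))))"
proof -
  have "vdegree glue v \<noteq> 0" if "v \<in> pverts glue" for v
    using vdegree_glue[of v] assms(3,4)[of v] that by auto
  then have "kemeny glue = resistance_sum glue (glue_resistance R1 R2) / (2 * real (card (parcs glue)))"
    by (intro kemeny_resistance pair_graph_glue resistance_glue assms)
      (metis UnI1 c_in_parts(1) empty_iff glue_verts)
  then show ?thesis by (simp add: resistance_sum_glue[OF assms(1,2)] card_parcs_glue)
qed

end

section \<open>Complete bipartite graphs\<close>

lemma sum_if_neq:
  assumes "finite A" "j \<in> A"
  shows "(\<Sum>k\<in>A. if k = j then 0 else r) = (real (card A) - 1) * r"
proof -
  have "card A > 0" using assms by (auto simp: card_gt_0_iff)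
  then show ?thesis using assms by (simp add: sum.remove[of A j] of_nat_diff Suc_leI)
qed

text \<open>The case \<open>i = j\<close> forces the value of \<open>\<tau> i\<close>, which leaves
  the equations off the diagonal.\<close>

lemma resistanceI:
  assumes "\<forall>i\<in>pverts G. R i i = 0"
    and "\<forall>i\<in>pverts G. \<forall>j\<in>pverts G. R i j = R j i"
    and "\<forall>i\<in>pverts G. \<forall>j\<in>pverts G. i \<noteq> j \<longrightarrow>
      laplacian G (\<lambda>u. R u j) i = laplacian G (\<lambda>u. R u i) i + 2"
  shows "resistance G R"
  unfolding resistance_def
  using assms by (auto intro!: exI[of _ "\<lambda>i. laplacian G (\<lambda>u. R u i) i + 2"])

locale complete_bipartite =
  fixes G :: "'v pair_pre_digraph" and U V :: "'v set"
  assumes verts_eq: "pverts G = U \<union> V" and disj: "U \<inter> V = {}"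
    and fin: "finite U" "finite V" and ne: "U \<noteq> {}" "V \<noteq> {}"
    and arcs_eq: "parcs G = U \<times> V \<union> V \<times> U"
begin

abbreviation m :: real where "m \<equiv> real (card U)"
abbreviation n :: real where "n \<equiv> real (card V)"

lemma pos: "m > 0" "n > 0"
  using fin ne by (auto simp: card_gt_0_iff)

lemma pair_graph_G: "pair_graph G"
proof (rule pair_graphI_complete_bipartite)
  show "K\<^bsub>card U,card V\<^esub> (with_proj G)"
    unfolding complete_bipartite_digraph_pair_def using verts_eq arcs_eq disj fin by auto
qed

lemma sum_verts: "(\<Sum>k\<in>pverts G. f k) = (\<Sum>k\<in>U. f k) + (\<Sum>k\<in>V. f k)"
  unfolding verts_eq using fin disj by (rule sum.union_disjoint)

lemma sum_adjacency:
  "i \<in> U \<Longrightarrow> (\<Sum>k\<in>pverts G. adjacency G i k * f k) = (\<Sum>k\<in>V. f k)"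
  "i \<in> V \<Longrightarrow> (\<Sum>k\<in>pverts G. adjacency G i k * f k) = (\<Sum>k\<in>U. f k)"
proof -
  assume i: "i \<in> U"
  have "(\<Sum>k\<in>U. adjacency G i k * f k) = 0" "(\<Sum>k\<in>V. adjacency G i k * f k) = (\<Sum>k\<in>V. f k)"
    using i disj by (auto simp: adjacency_def arcs_eq intro!: sum.neutral sum.cong)
  then show "(\<Sum>k\<in>pverts G. adjacency G i k * f k) = (\<Sum>k\<in>V. f k)" by (simp add: sum_verts)
next
  assume i: "i \<in> V"
  have "(\<Sum>k\<in>V. adjacency G i k * f k) = 0" "(\<Sum>k\<in>U. adjacency G i k * f k) = (\<Sum>k\<in>U. f k)"
    using i disj by (auto simp: adjacency_def arcs_eq intro!: sum.neutral sum.cong)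
  then show "(\<Sum>k\<in>pverts G. adjacency G i k * f k) = (\<Sum>k\<in>U. f k)" by (simp add: sum_verts)
qed

lemma vdegree_U: "v \<in> U \<Longrightarrow> real (vdegree G v) = n"
  using sum_adjacency(1)[of v "\<lambda>_. 1"] by (simp add: vdegree_conv_adjacency[OF pair_graph_G])

lemma vdegree_V: "v \<in> V \<Longrightarrow> real (vdegree G v) = m"
  using sum_adjacency(2)[of v "\<lambda>_. 1"] by (simp add: vdegree_conv_adjacency[OF pair_graph_G])

lemma vdegree_nonzero: "v \<in> pverts G \<Longrightarrow> vdegree G v \<noteq> 0"
  using vdegree_U[of v] vdegree_V[of v] pos by (auto simp: verts_eq)

lemma card_parcs: "real (card (parcs G)) = 2 * m * n"
  by (simp add: card_parcs_conv_vdegree[OF pair_graph_G] sum_verts vdegree_U vdegree_V)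

text \<open>The effective resistances of the complete bipartite graph. On one side, the paths of
  length 2 through the other side are in parallel; between the sides, edge-transitivity and Foster's
  theorem give the number of vertices minus 1 over the number of edges.\<close>

definition bip_distance :: "'v \<Rightarrow> 'v \<Rightarrow> real" where
  "bip_distance u v = (if u = v then 0 else if u \<in> U \<and> v \<in> U then 2 / n
     else if u \<in> V \<and> v \<in> V then 2 / m else (m + n - 1) / (m * n))"

lemma bip_distance_cases:
  "u \<in> U \<Longrightarrow> v \<in> U \<Longrightarrow> bip_distance u v = (if u = v then 0 else 2 / n)"
  "u \<in> V \<Longrightarrow> v \<in> V \<Longrightarrow> bip_distance u v = (if u = v then 0 else 2 / m)"
  "u \<in> U \<Longrightarrow> v \<in> V \<Longrightarrow> bip_distance u v = (m + n - 1) / (m * n)"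
  "u \<in> V \<Longrightarrow> v \<in> U \<Longrightarrow> bip_distance u v = (m + n - 1) / (m * n)"
  using disj by (auto simp: bip_distance_def)

lemma sum_bip_distance:
  "j \<in> U \<Longrightarrow> (\<Sum>k\<in>U. bip_distance k j) = (m - 1) * (2 / n)"
  "j \<in> V \<Longrightarrow> (\<Sum>k\<in>V. bip_distance k j) = (n - 1) * (2 / m)"
  "j \<in> U \<Longrightarrow> (\<Sum>k\<in>V. bip_distance k j) = n * ((m + n - 1) / (m * n))"
  "j \<in> V \<Longrightarrow> (\<Sum>k\<in>U. bip_distance k j) = m * ((m + n - 1) / (m * n))"
  by (simp_all add: bip_distance_cases sum_if_neq fin cong: sum.cong)

lemma laplacian_eq:
  "i \<in> U \<Longrightarrow> laplacian G f i = n * f i - (\<Sum>k\<in>V. f k)"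
  "i \<in> V \<Longrightarrow> laplacian G f i = m * f i - (\<Sum>k\<in>U. f k)"
  unfolding laplacian_def by (simp_all only: sum_adjacency) (simp_all add: sum_subtractf)

lemma bip_resistance: "resistance G bip_distance"
proof (rule resistanceI; intro ballI impI)
  fix i j assume "i \<in> pverts G" "j \<in> pverts G" and ij: "i \<noteq> j"
  then consider "i \<in> U" "j \<in> U" | "i \<in> U" "j \<in> V" | "i \<in> V" "j \<in> U" | "i \<in> V" "j \<in> V"
    by (auto simp: verts_eq)
  then show "laplacian G (\<lambda>u. bip_distance u j) i = laplacian G (\<lambda>u. bip_distance u i) i + 2"
    using pos ij by cases (simp_all only: laplacian_eq sum_bip_distance, simp_all add: bip_distance_cases field_simps)
qed (auto simp: bip_distance_def)

lemma bip_resistance_moment: "c \<in> U \<Longrightarrow> resistance_moment G bip_distance c = 3 * m + n - 3"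
  using pos by (simp add: resistance_moment_def sum_verts vdegree_U vdegree_V sum_bip_distance
      flip: sum_distrib_left)

lemma bip_resistance_sum: "resistance_sum G bip_distance = 2 * m * n * (2 * m + 2 * n - 3)"
proof -
  have "resistance_sum G bip_distance = (\<Sum>v\<in>pverts G. real (vdegree G v)
      * ((\<Sum>u\<in>U. n * bip_distance u v) + (\<Sum>u\<in>V. m * bip_distance u v)))"
    unfolding resistance_sum_def
    \<comment> \<open>The exchange makes the inner sum run over the first argument, as in
      \<open>sum_bip_distance\<close>.\<close>
    by (subst sum.swap, rule sum.cong[OF refl], subst sum_verts)
      (simp add: vdegree_U vdegree_V sum_distrib_left distrib_left ac_simps)
  also have "\<dots> = m * (n * (n * ((m - 1) * (2 / n)) + m * (n * ((m + n - 1) / (m * n)))))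
      + n * (m * (n * (m * ((m + n - 1) / (m * n))) + m * ((n - 1) * (2 / m))))"
    by (simp add: sum_verts vdegree_U vdegree_V sum_bip_distance flip: sum_distrib_left)
  also have "\<dots> = 2 * m * n * (2 * m + 2 * n - 3)"
    using pos by (simp add: field_simps)
  finally show ?thesis .
qed

end

section \<open>Spiders with additional edges\<close>

lemma pair_graph_add_all_edges:
  assumes "pair_graph G" "T \<subseteq> pverts G"
  shows "pair_graph (add_all_edges G T)"
proof -
  interpret pair_graph G by fact
  have "finite (T \<times> T)" using assms(2) pair_finite_verts by (blast intro: finite_subset)
  then have "finite {(u, v). u \<in> T \<and> v \<in> T \<and> u \<noteq> v}" by (rule rev_finite_subset) auto
  then show ?thesis using assms(2)
    by unfold_locales
      (auto simp: add_all_edges_def symmetric_def pair_finite_verts pair_finite_arcs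
        dest: in_arcsD1 in_arcsD2 no_loops' intro: arcs_symmetric intro!: symI)
qed

locale spider =
  fixes c x1 x2 x3 y1 y2 y3 :: 'v
  assumes dist: "distinct [c, x1, x2, x3, y1, y2, y3]"
begin

definition spider_graph :: "'v pair_pre_digraph" where
  "spider_graph = \<lparr> pverts = {c, x1, x2, x3, y1, y2, y3},
     parcs = {(c, x1), (c, x2), (c, x3), (x1, y1), (x2, y2), (x3, y3)}
       \<union> {(x1, c), (x2, c), (x3, c), (y1, x1), (y2, x2), (y3, x3)} \<rparr>"

text \<open>The row of a vertex in the matrix \<open>M\<close> below, each leaf sharing the row of
  its neighbour.\<close>

definition foot :: "'v \<Rightarrow> nat" where
  "foot u = (if u \<in> {x1, y1} then 1 else if u \<in> {x2, y2} then 2 else if u \<in> {x3, y3} then 3 else 0)"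

text \<open>
  \<open>M\<close> lists the resistances between \<open>c\<close>, \<open>x1\<close>, \<open>x2\<close>, \<open>x3\<close>, in this order; each \<open>y\<close> hangs off its
  \<open>x\<close> by a pendant edge, of resistance \<open>1\<close>.
\<close>

definition spider_distance :: "real list list \<Rightarrow> 'v \<Rightarrow> 'v \<Rightarrow> real" where
  "spider_distance M u v = (if u = v then 0 else M ! foot u ! foot v
     + (if u \<in> {y1, y2, y3} then 1 else 0) + (if v \<in> {y1, y2, y3} then 1 else 0))"

abbreviation "spider_edge \<equiv> add_all_edges spider_graph {x1, x2}"
abbreviation "spider_K3 \<equiv> add_all_edges spider_graph {x1, x2, x3}"

text \<open>Without the leaves there remain a star, a triangle with a pendant edge, and a complete
  graph on 4 vertices: tree distances, then \<open>2/3\<close> as resistances 1 and 2 in parallel,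
  then \<open>2/4\<close>.\<close>

abbreviation "dist_S \<equiv> [[0, 1, 1, 1], [1, 0, 2, 2], [1, 2, 0, 2], [1, 2, 2, 0]]"
abbreviation "dist_edge \<equiv> [[0, 2/3, 2/3, 1], [2/3, 0, 2/3, 5/3], [2/3, 2/3, 0, 5/3], [1, 5/3, 5/3, 0]]"
abbreviation "dist_K3 \<equiv> [[0, 1/2, 1/2, 1/2], [1/2, 0, 1/2, 1/2], [1/2, 1/2, 0, 1/2], [1/2, 1/2, 1/2, 0]]"

lemma vertices_neq:
  "c \<noteq> x1" "c \<noteq> x2" "c \<noteq> x3" "c \<noteq> y1" "c \<noteq> y2" "c \<noteq> y3"
  "x1 \<noteq> x2" "x1 \<noteq> x3" "x1 \<noteq> y1" "x1 \<noteq> y2" "x1 \<noteq> y3"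
  "x2 \<noteq> x3" "x2 \<noteq> y1" "x2 \<noteq> y2" "x2 \<noteq> y3"
  "x3 \<noteq> y1" "x3 \<noteq> y2" "x3 \<noteq> y3" "y1 \<noteq> y2" "y1 \<noteq> y3" "y2 \<noteq> y3"
  using dist by auto

lemmas [simp] = vertices_neq vertices_neq[symmetric]

lemma spider_verts [simp]: "pverts spider_graph = {c, x1, x2, x3, y1, y2, y3}"
  "pverts (add_all_edges spider_graph T) = {c, x1, x2, x3, y1, y2, y3}"
  by (simp_all add: spider_graph_def add_all_edges_def)

lemma spider_arcs:
  "parcs spider_graph = {(c, x1), (c, x2), (c, x3), (x1, y1), (x2, y2), (x3, y3)}
    \<union> {(x1, c), (x2, c), (x3, c), (y1, x1), (y2, x2), (y3, x3)}"
  "parcs (add_all_edges spider_graph T) = parcs spider_graph \<union> {(u, v). u \<in> T \<and> v \<in> T \<and> u \<noteq> v}"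
  by (simp_all add: spider_graph_def add_all_edges_def)

lemma pair_graph_spider: "pair_graph spider_graph"
  by unfold_locales (auto simp: spider_arcs symmetric_def sym_def)

lemma vdegree_spider:
  "real (vdegree spider_graph c) = 3" "real (vdegree spider_graph x1) = 2"
  "real (vdegree spider_graph x2) = 2" "real (vdegree spider_graph x3) = 2"
  "real (vdegree spider_graph y1) = 1" "real (vdegree spider_graph y2) = 1"
  "real (vdegree spider_graph y3) = 1"
  by (simp_all add: vdegree_conv_adjacency[OF pair_graph_spider] adjacency_def spider_arcs)

lemma pair_graph_edge: "pair_graph spider_edge" and pair_graph_K3: "pair_graph spider_K3"
  by (auto intro!: pair_graph_add_all_edges pair_graph_spider)

lemma vdegree_edge:
  "real (vdegree spider_edge c) = 3" "real (vdegree spider_edge x1) = 3"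
  "real (vdegree spider_edge x2) = 3" "real (vdegree spider_edge x3) = 2"
  "real (vdegree spider_edge y1) = 1" "real (vdegree spider_edge y2) = 1"
  "real (vdegree spider_edge y3) = 1"
  by (simp_all add: vdegree_conv_adjacency[OF pair_graph_edge] adjacency_def spider_arcs)

lemma vdegree_K3:
  "real (vdegree spider_K3 c) = 3" "real (vdegree spider_K3 x1) = 4"
  "real (vdegree spider_K3 x2) = 4" "real (vdegree spider_K3 x3) = 4"
  "real (vdegree spider_K3 y1) = 1" "real (vdegree spider_K3 y2) = 1"
  "real (vdegree spider_K3 y3) = 1"
  by (simp_all add: vdegree_conv_adjacency[OF pair_graph_K3] adjacency_def spider_arcs)

lemma foot_simps [simp]:
  "foot c = 0" "foot x1 = 1" "foot x2 = 2" "foot x3 = 3" "foot y1 = 1" "foot y2 = 2" "foot y3 = 3"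
  by (auto simp: foot_def)

lemma laplacian_spider:
  "laplacian spider_graph f c = (f c - f x1) + (f c - f x2) + (f c - f x3)"
  "laplacian spider_graph f x1 = (f x1 - f c) + (f x1 - f y1)"
  "laplacian spider_graph f x2 = (f x2 - f c) + (f x2 - f y2)"
  "laplacian spider_graph f x3 = (f x3 - f c) + (f x3 - f y3)"
  "laplacian spider_graph f y1 = (f y1 - f x1)"
  "laplacian spider_graph f y2 = (f y2 - f x2)"
  "laplacian spider_graph f y3 = (f y3 - f x3)"
  by (simp_all add: laplacian_def adjacency_def spider_arcs)

lemma laplacian_edge:
  "laplacian spider_edge f c = (f c - f x1) + (f c - f x2) + (f c - f x3)"
  "laplacian spider_edge f x1 = (f x1 - f c) + (f x1 - f x2) + (f x1 - f y1)"
  "laplacian spider_edge f x2 = (f x2 - f c) + (f x2 - f x1) + (f x2 - f y2)"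
  "laplacian spider_edge f x3 = (f x3 - f c) + (f x3 - f y3)"
  "laplacian spider_edge f y1 = (f y1 - f x1)"
  "laplacian spider_edge f y2 = (f y2 - f x2)"
  "laplacian spider_edge f y3 = (f y3 - f x3)"
  by (simp_all add: laplacian_def adjacency_def spider_arcs)

lemma laplacian_K3:
  "laplacian spider_K3 f c = (f c - f x1) + (f c - f x2) + (f c - f x3)"
  "laplacian spider_K3 f x1 = (f x1 - f c) + (f x1 - f x2) + (f x1 - f x3) + (f x1 - f y1)"
  "laplacian spider_K3 f x2 = (f x2 - f c) + (f x2 - f x1) + (f x2 - f x3) + (f x2 - f y2)"
  "laplacian spider_K3 f x3 = (f x3 - f c) + (f x3 - f x1) + (f x3 - f x2) + (f x3 - f y3)"
  "laplacian spider_K3 f y1 = (f y1 - f x1)"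
  "laplacian spider_K3 f y2 = (f y2 - f x2)"
  "laplacian spider_K3 f y3 = (f y3 - f x3)"
  by (simp_all add: laplacian_def adjacency_def spider_arcs)

section \<open>Effective resistances of the three spiders and their sums\<close>

lemma resistance_spider: "resistance spider_graph (spider_distance dist_S)"
  by (rule resistanceI) (simp_all add: laplacian_spider spider_distance_def)

lemma resistance_edge: "resistance spider_edge (spider_distance dist_edge)"
  by (rule resistanceI) (simp_all add: laplacian_edge spider_distance_def)

lemma resistance_K3: "resistance spider_K3 (spider_distance dist_K3)"
  by (rule resistanceI) (simp_all add: laplacian_K3 spider_distance_def)

lemma resistance_values_spider:
  "resistance_sum spider_graph (spider_distance dist_S) = 228"
  "resistance_moment spider_graph (spider_distance dist_S) c = 12"
  "real (card (parcs spider_graph)) = 12"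
  by (simp_all add: resistance_sum_def resistance_moment_def card_parcs_conv_vdegree
      pair_graph_spider vdegree_spider spider_distance_def)

lemma resistance_values_edge:
  "resistance_sum spider_edge (spider_distance dist_edge) = 688 / 3"
  "resistance_moment spider_edge (spider_distance dist_edge) c = 34 / 3"
  "real (card (parcs spider_edge)) = 14"
  by (simp_all add: resistance_sum_def resistance_moment_def card_parcs_conv_vdegree
      pair_graph_edge vdegree_edge spider_distance_def)

lemma resistance_values_K3:
  "resistance_sum spider_K3 (spider_distance dist_K3) = 222"
  "resistance_moment spider_K3 (spider_distance dist_K3) c = 21 / 2"
  "real (card (parcs spider_K3)) = 18"
  by (simp_all add: resistance_sum_def resistance_moment_def card_parcs_conv_vdegree
      pair_graph_K3 vdegree_K3 spider_distance_def)

end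

section \<open>The spider attached to a complete bipartite graph\<close>

text \<open>Walks can be reversed, so any two vertices are joined through the hub
  \<open>c\<close>.\<close>

lemma connected_graphI:
  assumes "pair_graph G" "c \<in> pverts G" "\<And>v. v \<in> pverts G \<Longrightarrow> v \<rightarrow>\<^sup>*\<^bsub>with_proj G\<^esub> c"
  shows "connected_graph G"
proof -
  interpret pair_graph G by fact
  have "u \<rightarrow>\<^sup>*\<^bsub>with_proj G\<^esub> v" if "u \<in> pverts G" "v \<in> pverts G" for u v
    using assms(3) that symmetric_reachable[OF sym_arcs] reachable_trans by blast
  then have "strongly_connected (with_proj (mk_symmetric (with_proj G)))"
    using assms(2) reachable_mk_symmetricI
    by (auto simp: strongly_connected_def mk_symmetric_def)
  then show ?thesis using assms(1) by (simp add: connected_graph_def connected_def)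
qed

text \<open>Vertices in \<open>U\<close> have degree \<open>card V = 3\<close>, so \<open>c\<close>
  is taken there and \<open>m\<close> is the parameter \<open>a\<close>.\<close>

locale spider_on_bipartite =
  complete_bipartite B U V + spider c x1 x2 x3 y1 y2 y3
  for B :: "'v pair_pre_digraph" and U V and c x1 x2 x3 y1 y2 y3 :: 'v +
  assumes center: "c \<in> U" and card_V: "card V = 3"
    and shared: "pverts B \<inter> pverts spider_graph = {c}"
begin

lemma glued_ext: "pair_graph G \<Longrightarrow> pverts G = pverts spider_graph \<Longrightarrow> glued B G c"
  using shared pair_graph_G by (simp add: glued_def)

definition H where "H = glued.glue B spider_graph"

lemma H_eq: "H = \<lparr> pverts = pverts B \<union> pverts spider_graph,
    parcs = parcs B \<union> parcs spider_graph \<rparr>"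
  unfolding H_def by (rule glued.glue_def[OF glued_ext[OF pair_graph_spider refl]])

text \<open>Edges inside the spider can be added before gluing, so the bipartite part keeps its
  data.\<close>

lemma add_all_edges_H:
  assumes "T \<subseteq> pverts spider_graph"
  shows "add_all_edges H T = glued.glue B (add_all_edges spider_graph T)"
  by (subst glued.glue_def[OF glued_ext[OF pair_graph_add_all_edges[OF pair_graph_spider assms]]])
    (simp_all add: add_all_edges_def H_eq Un_assoc)

text \<open>For the bipartite part, the resistance sum is \<open>12 * m^2 + 18 * m\<close>, the
  number of arcs \<open>6 * m\<close> and the moment at \<open>c\<close> is
  \<open>3 * m\<close>.\<close>

lemma kemeny_attach:
  assumes "pair_graph G" "pverts G = pverts spider_graph" "resistance G R"
    and "\<And>v. v \<in> pverts G \<Longrightarrow> vdegree G v \<noteq> 0"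
  shows "kemeny (glued.glue B G) = (12 * m\<^sup>2 + 18 * m + resistance_sum G R
      + 2 * (6 * m * resistance_moment G R c + real (card (parcs G)) * (3 * m)))
      / (2 * (6 * m + real (card (parcs G))))"
proof -
  interpret glued B G c by (rule glued_ext[OF assms(1,2)])
  show ?thesis
    using kemeny_glue[OF bip_resistance assms(3) vdegree_nonzero assms(4)]
    by (simp add: bip_resistance_sum bip_resistance_moment center card_parcs card_V
        power2_eq_square algebra_simps)
qed

lemma kemeny_H: "kemeny H = (12 * m\<^sup>2 + 234 * m + 228) / (12 * m + 24)"
  unfolding H_def using vdegree_spider
  by (subst kemeny_attach[OF pair_graph_spider refl resistance_spider])
    (auto simp: resistance_values_spider algebra_simps)

lemma kemeny_edge: "kemeny (add_all_edges H {x1, x2}) = (12 * m\<^sup>2 + 238 * m + 688 / 3) / (12 * m + 28)"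
  using vdegree_edge
  by (subst add_all_edges_H, simp, subst kemeny_attach[OF pair_graph_edge _ resistance_edge])
    (auto simp: resistance_values_edge algebra_simps)

lemma kemeny_K3: "kemeny (add_all_edges H {x1, x2, x3}) = (12 * m\<^sup>2 + 252 * m + 222) / (12 * m + 36)"
  using vdegree_K3
  by (subst add_all_edges_H, simp, subst kemeny_attach[OF pair_graph_K3 _ resistance_K3])
    (auto simp: resistance_values_K3 algebra_simps)

lemma not_braess_edge: "\<not> braess_edge H x1 x2"
proof -
  \<comment> \<open>The cubic and quadratic terms agree; the right side is larger by
    \<open>824 * m + 880\<close>.\<close>
  have "(12 * m\<^sup>2 + 238 * m + 688 / 3) * (12 * m + 24) < (12 * m\<^sup>2 + 234 * m + 228) * (12 * m + 28)"
    using pos by (simp add: power2_eq_square algebra_simps)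
  then have "kemeny (add_all_edges H {x1, x2}) < kemeny H"
    unfolding kemeny_H kemeny_edge using pos by (subst frac_less_eq) (auto simp: divide_simps)
  then show ?thesis by (simp add: braess_edge_def)
qed

lemma kemeny_K3_greater:
  assumes "card U \<ge> 36"
  shows "kemeny (add_all_edges H {x1, x2, x3}) > kemeny H"
proof -
  have m: "m \<ge> 36" using assms by simp
  then have "36 * m \<le> m * m" by (intro mult_right_mono) auto
  \<comment> \<open>After cross-multiplication the gain is
    \<open>72 * m^2 - 2448 * m - 2880\<close>. By \<open>m >= 36\<close> the first two terms give at
    least \<open>144 * m >= 5184\<close>.\<close>
  then have "2880 + 2448 * m < 72 * (m * m)" using m by linarith
  then have "(12 * m\<^sup>2 + 234 * m + 228) * (12 * m + 36) < (12 * m\<^sup>2 + 252 * m + 222) * (12 * m + 24)"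
    by (simp add: power2_eq_square algebra_simps)
  then show ?thesis
    unfolding kemeny_H kemeny_K3 using pos by (subst frac_less_eq) (auto simp: divide_simps)
qed

lemma connected_H: "connected_graph H"
proof (rule connected_graphI)
  have glued: "glued B spider_graph c" by (rule glued_ext[OF pair_graph_spider refl])
  show "pair_graph H" unfolding H_def by (rule glued.pair_graph_glue[OF glued])
  then interpret HG: pair_graph H .
  show cH: "c \<in> pverts H" by (simp add: H_eq)
  obtain w where w: "w \<in> V" using ne by blast
  \<comment> \<open>Every vertex is within distance 2 of \<open>c\<close>: the rest of
    \<open>U\<close> through \<open>w\<close>, the leaves through their neighbours.\<close>
  have "(v, c) \<in> parcs H \<or> (\<exists>w. (v, w) \<in> parcs H \<and> (w, c) \<in> parcs H)" if "v \<in> pverts H" for v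
    using that w center by (auto simp: H_eq verts_eq arcs_eq spider_arcs)
  then show "v \<rightarrow>\<^sup>*\<^bsub>with_proj H\<^esub> c" if "v \<in> pverts H" for v
    using that HG.reachable_adjI HG.adj_reachable_trans by blast
qed

lemma independent_feet: "independent_vertices H {x1, x2, x3}"
proof -
  \<comment> \<open>Only spider arcs can then join the three vertices, and each of these has
    \<open>c\<close> or a leaf as an end.\<close>
  have "x \<notin> pverts B" if "x \<in> pverts spider_graph" "x \<noteq> c" for x
    using shared that by blast
  from this[of x1] this[of x2] this[of x3] show ?thesis
    by (auto simp: independent_vertices_def H_eq spider_arcs arcs_eq verts_eq)
qed

lemma braess_K3_feet: "card U \<ge> 36 \<Longrightarrow> braess_K3 H {x1, x2, x3}"
  using connected_H independent_feet kemeny_K3_greater by (simp add: braess_K3_def)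

end

theorem corollary5p4:
  fixes a :: nat and B S H :: "'v pair_pre_digraph" and c :: 'v
  assumes "a \<ge> 36"
    and "complete_bipartite_digraph a 3 (with_proj B)"
    and "c \<in> pverts B" and "vdegree B c = 3"
    and "spider_2_3 S c"
    and "attached_at B S c H"
  shows "\<exists>T. braess_K3 H T \<and> (\<forall>u\<in>T. \<forall>v\<in>T. \<not> braess_edge H u v)"
proof -
  obtain U V where UV: "pverts B = U \<union> V" "U \<inter> V = {}" "card U = a" "card V = 3"
      "parcs B = U \<times> V \<union> V \<times> U" "finite (pverts B)"
    using assms(2) unfolding complete_bipartite_digraph_pair_def by blast
  interpret B: complete_bipartite B U V
    using UV assms(1) by unfold_locales (auto simp: card_gt_0_iff)
  \<comment> \<open>In \<open>V\<close> the degree would be \<open>a\<close>, which is not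
    3.\<close>
  have c: "c \<in> U"
    using B.vdegree_V[of c] assms(1,3,4) UV by auto
  obtain x1 x2 x3 y1 y2 y3 where x: "distinct [c, x1, x2, x3, y1, y2, y3]"
      "pverts S = {c, x1, x2, x3, y1, y2, y3}"
      "parcs S = {(c, x1), (c, x2), (c, x3), (x1, y1), (x2, y2), (x3, y3)}
         \<union> {(x1, c), (x2, c), (x3, c), (y1, x1), (y2, x2), (y3, x3)}"
    using assms(5) unfolding spider_2_3_def by blast
  \<comment> \<open>Permuting the legs leaves \<open>S\<close>, and hence \<open>H\<close>,
    unchanged. The result for the pair \<open>x1\<close>, \<open>x2\<close> thereby transfers to
    every pair.\<close>
  define spider_labels where "spider_labels x1 x2 x3 y1 y2 y3 \<longleftrightarrow>
      distinct [c, x1, x2, x3, y1, y2, y3] \<and> S = spider.spider_graph c x1 x2 x3 y1 y2 y3"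
    for x1 x2 x3 y1 y2 y3
  have S: "S = spider.spider_graph c x1 x2 x3 y1 y2 y3"
    using x by (simp add: spider.spider_graph_def spider_def)
  have H: "spider_on_bipartite B U V c z1 z2 z3 w1 w2 w3
      \<and> H = spider_on_bipartite.H B c z1 z2 z3 w1 w2 w3"
    if "spider_labels z1 z2 z3 w1 w2 w3" for z1 z2 z3 w1 w2 w3
  proof -
    interpret spider c z1 z2 z3 w1 w2 w3
      using that by (simp add: spider_labels_def spider_def)
    have S: "S = spider_graph" using that by (simp add: spider_labels_def)
    interpret spider_on_bipartite B U V c z1 z2 z3 w1 w2 w3
      using c UV assms(6) S by unfold_locales (auto simp: attached_at_def)
    show ?thesis
      using assms(6) spider_on_bipartite_axioms S unfolding attached_at_def H_eq by simp
  qed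
  have no_edge: "\<not> braess_edge H z1 z2" if "spider_labels z1 z2 z3 w1 w2 w3" for z1 z2 z3 w1 w2 w3
    using H[OF that] spider_on_bipartite.not_braess_edge by metis
  \<comment> \<open>One labelling for each ordered pair of distinct vertices in the
    triangle.\<close>
  have labels: "spider_labels x1 x2 x3 y1 y2 y3" "spider_labels x2 x1 x3 y2 y1 y3"
    "spider_labels x1 x3 x2 y1 y3 y2" "spider_labels x3 x1 x2 y3 y1 y2"
    "spider_labels x2 x3 x1 y2 y3 y1" "spider_labels x3 x2 x1 y3 y2 y1"
    using x by (auto simp: spider_labels_def spider.spider_graph_def spider_def S)
  have "braess_K3 H {x1, x2, x3}"
    using H[OF labels(1)] spider_on_bipartite.braess_K3_feet UV(3) assms(1) by metis
  moreover have "\<not> braess_edge H u u" for u by (simp add: braess_edge_def)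
  ultimately show ?thesis
    using labels[THEN no_edge] by (intro exI[of _ "{x1, x2, x3}"]) auto
qed

end
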